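(* Let $A=\{0,1\}$, $\lambda\in(0,1)$, let $p(\cdot|0),p(\cdot|1)$ be probability measures on $\{0,1\}$ with $\delta:=\lambda|p(1|1)-p(1|0)|>0$, and let $n>d\ge1$. With $P^{(j)}_n$ as defined in the context, for all $j,k\in\{-d,\dots,-1\}$, $$KL(P^{(j)}_n\,\|\,P^{(k)}_n)\le\frac{2n\delta^2}{1-\lambda}.$$ In particular, if $\beta\in(0,1)$, $d=n\beta$ and $$\delta^2\le\frac{1-\lambda}{2n}\left(\frac{\log(n\beta)}2-\log 2\right),$$ then $$\inf_{\hat\Lambda_n}\ \sup_{p\in MTD_{d,\delta}}\mathbb P_p(\hat\Lambda_n\ne\Lambda)\ge\frac14,$$ where the infimum is over all lag estimators $\hat\Lambda_n$ based on a sample $X_{1:n}$ of size $n$.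
   Context: $x_{s:t}=(x_s,\dots,x_t)$. $d_{TV}(\mu,\nu)=\frac12\sum_{a\in A}|\mu(a)-\nu(a)|$. MTD model of order $d\ge1$: a stationary $A$-valued Markov chain $(X_t)_{t\in\mathbb Z}$ of order $d$ with transition probabilities $p(a|x_{-d:-1})=\lambda_0p_0(a)+\sum_{j=-d}^{-1}\lambda_jp_j(a|x_j)$, where $\lambda_{-d},\dots,\lambda_0\in[0,1]$ sum to $1$ and $p_0(\cdot)$, $p_j(\cdot|b)$ are probability measures on $A$. $\delta_j=\lambda_j\max_{b,c\in A}d_{TV}(p_j(\cdot|b),p_j(\cdot|c))$, $\Lambda=\{j\in\{-d,\dots,-1\}:\delta_j>0\}$ (set of relevant lags), $\delta_{min}=\min_{j\in\Lambda}\delta_j$. For $j\in\{-d,\dots,-1\}$, $\mathbb P^{(j)}$ is the probability measure under which $(X_t)_{t\in\mathbb Z}$ is the stationary MTD model with transition probabilities $$p^{(j)}(1|x_{-d:-1})=\frac{1-\lambda}2+\lambda p(1|x_j),\qquad p^{(j)}(0|\cdot)=1-p^{(j)}(1|\cdot),$$ and $P^{(j)}_n(x_{1:n})=\mathbb P^{(j)}(X_{1:n}=x_{1:n})$. $KL(P\|Q)=\sum_xP(x)\log(P(x)/Q(x))$ (natural logarithm). $MTD_{d,\delta}$ is the set of all transition probabilities $p$ of MTD models of order $d$ on $A=\{0,1\}$ with $\delta_{min}\ge\delta$. For $p\in MTD_{d,\delta}$, $\mathbb P_p$ is the law under which $(X_t)$ is a stationary MTD model with transition probabilities $p$, and $\Lambda$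 is the corresponding set of relevant lags. A lag estimator is a function of $X_{1:n}$ with values in the subsets of $\{-d,\dots,-1\}$. *)

theory Defs
  imports "HOL-Probability.Probability"
begin

section \<open>Mixture transition distribution models\<close>

definition d_TV :: "'a::finite pmf \<Rightarrow> 'a pmf \<Rightarrow> real" where
  "d_TV \<mu> \<nu> = 1/2 * (\<Sum>a\<in>UNIV. \<bar>pmf \<mu> a - pmf \<nu> a\<bar>)"

definition lags :: "nat \<Rightarrow> int set" where
  "lags d = {- int d..-1}"

text \<open>Only the weights at indices in \<open>{-d..0}\<close> and the kernels at indices in \<open>{-d..-1}\<close> matter;
  \<open>mtd_kernel \<theta> j b\<close> is the measure $p_j(\cdot | b)$.\<close>

record 'a mtd_params =
  mtd_weight :: "int \<Rightarrow> real"
  mtd_base :: "'a pmf"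
  mtd_kernel :: "int \<Rightarrow> 'a \<Rightarrow> 'a pmf"

definition mtd_valid :: "nat \<Rightarrow> 'a mtd_params \<Rightarrow> bool" where
  "mtd_valid d \<theta> \<longleftrightarrow>
     (\<forall>j\<in>{- int d..0}. mtd_weight \<theta> j \<in> {0..1}) \<and> (\<Sum>j\<in>{- int d..0}. mtd_weight \<theta> j) = 1"

text \<open>Transition probabilities take the next symbol and the past. The past is a function on all
  of \<open>int\<close>; only its values on \<open>lags d\<close> are looked at.\<close>

type_synonym 'a trans = "'a \<Rightarrow> (int \<Rightarrow> 'a) \<Rightarrow> real"

definition mtd_trans :: "nat \<Rightarrow> 'a mtd_params \<Rightarrow> 'a trans" where
  "mtd_trans d \<theta> a x =
     mtd_weight \<theta> 0 * pmf (mtd_base \<theta>) a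
     + (\<Sum>j\<in>lags d. mtd_weight \<theta> j * pmf (mtd_kernel \<theta> j (x j)) a)"

definition mtd_delta :: "'a::finite mtd_params \<Rightarrow> int \<Rightarrow> real" where
  "mtd_delta \<theta> j =
     mtd_weight \<theta> j * Max {d_TV (mtd_kernel \<theta> j b) (mtd_kernel \<theta> j c) | b c. True}"

definition mtd_lags :: "nat \<Rightarrow> 'a::finite mtd_params \<Rightarrow> int set" where
  "mtd_lags d \<theta> = {j \<in> lags d. mtd_delta \<theta> j > 0}"

definition mtd_delta_min :: "nat \<Rightarrow> 'a::finite mtd_params \<Rightarrow> real" where
  "mtd_delta_min d \<theta> = Min (mtd_delta \<theta> ` mtd_lags d \<theta>)"

text \<open>The minimum over the relevant lags presupposes that there is at least one.\<close>

definition MTD :: "nat \<Rightarrow> real \<Rightarrow> bool trans set" where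
  "MTD d \<delta> = {mtd_trans d \<theta> | \<theta>. mtd_valid d \<theta> \<and> mtd_lags d \<theta> \<noteq> {} \<and> mtd_delta_min d \<theta> \<ge> \<delta>}"

text \<open>Different parameters can give the same transition probabilities, but the set of relevant
  lags is the same for all of them (lemma \<open>relevant_lags_mtd_trans\<close> below).\<close>

definition relevant_lags :: "nat \<Rightarrow> 'a::finite trans \<Rightarrow> int set" where
  "relevant_lags d p = (THE L. \<exists>\<theta>. mtd_valid d \<theta> \<and> p = mtd_trans d \<theta> \<and> L = mtd_lags d \<theta>)"

lemma mtd_weight_d_TV_eq:
  fixes \<theta> :: "'a::finite mtd_params"
  assumes "mtd_valid d \<theta>" "j \<in> lags d"
  shows "mtd_weight \<theta> j * d_TV (mtd_kernel \<theta> j b) (mtd_kernel \<theta> j c) =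
    1/2 * (\<Sum>a\<in>UNIV. \<bar>mtd_trans d \<theta> a ((\<lambda>_. b)(j := b)) - mtd_trans d \<theta> a ((\<lambda>_. b)(j := c))\<bar>)"
proof -
  have w: "mtd_weight \<theta> j \<ge> 0"
    using assms by (auto simp: mtd_valid_def lags_def)
  have fin: "finite (lags d)" by (simp add: lags_def)
  have "mtd_trans d \<theta> a ((\<lambda>_. b)(j := b)) - mtd_trans d \<theta> a ((\<lambda>_. b)(j := c))
      = mtd_weight \<theta> j * (pmf (mtd_kernel \<theta> j b) a - pmf (mtd_kernel \<theta> j c) a)" for a
    unfolding mtd_trans_def sum.remove[OF fin assms(2)] by (simp add: algebra_simps)
  then show ?thesis
    using w by (simp add: d_TV_def abs_mult sum_distrib_left mult_ac)
qed

lemma mtd_delta_cong: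
  fixes \<theta> \<theta>' :: "'a::finite mtd_params"
  assumes "mtd_valid d \<theta>" "mtd_valid d \<theta>'" "mtd_trans d \<theta> = mtd_trans d \<theta>'" "j \<in> lags d"
  shows "mtd_delta \<theta> j = mtd_delta \<theta>' j"
proof -
  have eq: "mtd_delta \<eta> j =
      Max {mtd_weight \<eta> j * d_TV (mtd_kernel \<eta> j b) (mtd_kernel \<eta> j c) | b c. True}"
    if "mtd_valid d \<eta>" for \<eta> :: "'a mtd_params"
  proof -
    let ?D = "{d_TV (mtd_kernel \<eta> j b) (mtd_kernel \<eta> j c) | b c. True}"
    have D: "?D = (\<lambda>(b, c). d_TV (mtd_kernel \<eta> j b) (mtd_kernel \<eta> j c)) ` UNIV" by auto
    have w: "mtd_weight \<eta> j \<ge> 0"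
      using that assms(4) by (auto simp: mtd_valid_def lags_def)
    have "mono (\<lambda>x. mtd_weight \<eta> j * x)"
      using w by (auto simp: mono_def intro: mult_left_mono)
    moreover have "finite ?D" "?D \<noteq> {}" unfolding D by auto
    ultimately have "mtd_delta \<eta> j = Max ((\<lambda>x. mtd_weight \<eta> j * x) ` ?D)"
      unfolding mtd_delta_def by (rule mono_Max_commute)
    also have "(\<lambda>x. mtd_weight \<eta> j * x) ` ?D =
        {mtd_weight \<eta> j * d_TV (mtd_kernel \<eta> j b) (mtd_kernel \<eta> j c) | b c. True}" by auto
    finally show ?thesis .
  qed
  show ?thesis
    unfolding eq[OF assms(1)] eq[OF assms(2)]
      mtd_weight_d_TV_eq[OF assms(1,4)] mtd_weight_d_TV_eq[OF assms(2,4)] assms(3) ..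
qed

lemma relevant_lags_mtd_trans:
  fixes \<theta> :: "'a::finite mtd_params"
  assumes "mtd_valid d \<theta>"
  shows "relevant_lags d (mtd_trans d \<theta>) = mtd_lags d \<theta>"
  unfolding relevant_lags_def
proof (rule the_equality)
  show "\<exists>\<theta>'. mtd_valid d \<theta>' \<and> mtd_trans d \<theta> = mtd_trans d \<theta>' \<and> mtd_lags d \<theta> = mtd_lags d \<theta>'"
    using assms by blast
next
  fix L assume "\<exists>\<theta>'. mtd_valid d \<theta>' \<and> mtd_trans d \<theta> = mtd_trans d \<theta>' \<and> L = mtd_lags d \<theta>'"
  then show "L = mtd_lags d \<theta>"
    using mtd_delta_cong[OF assms] by (auto simp: mtd_lags_def)
qed


section \<open>Stationary chains of order d\<close>

text \<open>A process indexed by \<open>int\<close> is given by its law on the product space, \<open>X t\<close> being the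
  coordinate at time \<open>t\<close>. The conditional probability of the next symbol is prescribed given every
  finite past of length \<open>m \<ge> d\<close> that has positive probability. For some \<open>p\<close> (for instance copying
  the previous symbol) more than one law satisfies this predicate.\<close>

abbreviation path_space :: "(int \<Rightarrow> 'a) measure" where
  "path_space \<equiv> PiM UNIV (\<lambda>_. count_space UNIV)"

definition stationary_chain :: "nat \<Rightarrow> 'a trans \<Rightarrow> (int \<Rightarrow> 'a) measure \<Rightarrow> bool" where
  "stationary_chain d p M \<longleftrightarrow>
     prob_space M \<and> sets M = sets path_space \<and>
     (\<forall>s. distr M path_space (\<lambda>X t. X (t + s)) = M) \<and>
     (\<forall>t m x a. d \<le> m \<longrightarrow> \<P>(X in M. \<forall>i\<in>{t - int m..<t}. X i = x i) > 0 \<longrightarrow>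
        \<P>(X in M. X t = a \<bar> \<forall>i\<in>{t - int m..<t}. X i = x i) = p a (\<lambda>j. x (t + j)))"

definition sample :: "nat \<Rightarrow> (int \<Rightarrow> 'a) \<Rightarrow> 'a list" where
  "sample n X = map X [1..int n]"

definition sample_prob :: "nat \<Rightarrow> (int \<Rightarrow> 'a) measure \<Rightarrow> 'a list \<Rightarrow> real" where
  "sample_prob n M xs = \<P>(X in M. sample n X = xs)"

text \<open>Kullback-Leibler divergence on a finite set \<open>S\<close>. The case distinction is needed because
  \<open>P x / 0 = 0\<close> and \<open>ln 0 = 0\<close>; terms with \<open>P x = 0\<close> vanish.\<close>

definition KL :: "'b set \<Rightarrow> ('b \<Rightarrow> real) \<Rightarrow> ('b \<Rightarrow> real) \<Rightarrow> ereal" where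
  "KL S P Q =
     (if \<exists>x\<in>S. P x > 0 \<and> Q x = 0 then \<infinity> else ereal (\<Sum>x\<in>S. P x * ln (P x / Q x)))"


section \<open>Single-lag binary models and lag estimators\<close>

text \<open>The alphabet $\{0,1\}$ is \<open>bool\<close>, with \<open>True\<close> for 1.\<close>

definition single_lag :: "real \<Rightarrow> (bool \<Rightarrow> bool pmf) \<Rightarrow> int \<Rightarrow> bool trans" where
  "single_lag lam q j a x =
     (let r = (1 - lam) / 2 + lam * pmf (q (x j)) True in if a then r else 1 - r)"

definition lag_estimators :: "nat \<Rightarrow> nat \<Rightarrow> (bool list \<Rightarrow> int set) set" where
  "lag_estimators n d = {f. \<forall>xs. length xs = n \<longrightarrow> f xs \<subseteq> lags d}"

end

theory Submission
  imports Defs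
begin

text \<open>The Kullback-Leibler divergence is bounded by the chain rule, one symbol at a time. A step on
  which both lags are visible contributes only if the symbols at the two lags differ, which has
  probability at most $(1+\lambda)/2$, and then at most the chi-square term
  $4\delta^2/(1-\lambda^2)$; the product is $2\delta^2/(1-\lambda)$. While a lag is not yet visible,
  the next symbol is distributed according to the invariant law, which is closer still.

  For the lower bound, every single-lag law lies in the class. If each of the \<open>d\<close> laws gave its
  own lag probability above 3/4, some lag \<open>j\<close> would be named with probability at most \<open>1/d\<close>
  under the law with lag \<open>-1\<close>, and the divergence of law \<open>j\<close> from that law would be at least
  \<open>3/4 * ln d - ln 2\<close>, more than allowed.\<close>

section \<open>Words over the binary alphabet\<close>

abbreviation words :: "nat \<Rightarrow> bool list set" where
  "words m \<equiv> {xs. length xs = m}"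

lemma finite_words: "finite (words m)"
  using finite_lists_length_eq[of "UNIV :: bool set" m] by simp

lemma sum_words_0: "(\<Sum>xs\<in>words 0. g xs) = g []"
proof -
  have "words 0 = {[]}" by auto
  then show ?thesis by simp
qed

lemma sum_words_snoc:
  fixes g :: "bool list \<Rightarrow> real"
  shows "(\<Sum>xs\<in>words (Suc m). g xs) = (\<Sum>ys\<in>words m. \<Sum>a\<in>UNIV. g (ys @ [a]))"
proof -
  have "(\<Sum>ys\<in>words m. \<Sum>a\<in>UNIV. g (ys @ [a])) = (\<Sum>(ys, a)\<in>words m \<times> UNIV. g (ys @ [a]))"
    by (rule sum.cartesian_product)
  also have "\<dots> = (\<Sum>xs\<in>words (Suc m). g xs)"
    by (rule sum.reindex_bij_witness[where j = "\<lambda>(ys, a). ys @ [a]" and i = "\<lambda>xs. (butlast xs, last xs)"])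
       (auto simp: length_Suc_conv_rev)
  finally show ?thesis by simp
qed

lemma sum_words_Cons:
  fixes g :: "bool list \<Rightarrow> real"
  shows "(\<Sum>xs\<in>words (Suc m). g xs) = (\<Sum>ys\<in>words m. \<Sum>a\<in>UNIV. g (a # ys))"
proof -
  have "(\<Sum>ys\<in>words m. \<Sum>a\<in>UNIV. g (a # ys)) = (\<Sum>(ys, a)\<in>words m \<times> UNIV. g (a # ys))"
    by (rule sum.cartesian_product)
  also have "\<dots> = (\<Sum>xs\<in>words (Suc m). g xs)"
    by (rule sum.reindex_bij_witness[where j = "\<lambda>(ys, a). a # ys" and i = "\<lambda>xs. (tl xs, hd xs)"])
       (auto simp: length_Suc_conv)
  finally show ?thesis by simp
qed

section \<open>Word probabilities of a single-lag chain\<close>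

text \<open>Strict positivity drives everything below: it gives uniqueness of the invariant law and
  makes every word probability positive, so that all logarithms are genuine.\<close>

locale binary_kernel =
  fixes R :: "bool \<Rightarrow> bool \<Rightarrow> real"
  assumes R_pos: "0 < R b a"
    and R_sum: "(\<Sum>a\<in>UNIV. R b a) = 1"
begin

text \<open>The invariant law of the two-state chain with kernel \<open>R\<close>: the mass at
  \<open>a\<close> is proportional to the probability of jumping into \<open>a\<close> from the
  other symbol.\<close>

definition stat :: "bool \<Rightarrow> real" where
  "stat a = R (\<not> a) a / (R True False + R False True)"

lemma R_False: "R b False = 1 - R b True"
  using R_sum[of b] by (simp add: UNIV_bool)

lemma stat_pos: "0 < stat a"
  by (simp add: stat_def R_pos add_pos_pos)

lemma stat_sum: "(\<Sum>a\<in>UNIV. stat a) = 1"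
  using R_pos[of True False] R_pos[of False True]
  by (simp add: stat_def UNIV_bool add_divide_distrib[symmetric])

lemma stat_invariant: "(\<Sum>c\<in>UNIV. stat c * R c a) = stat a"
proof -
  have "(\<Sum>c\<in>UNIV. R (\<not> c) c * R c a) = R (\<not> a) a"
    by (cases a) (simp_all add: UNIV_bool R_False algebra_simps)
  then show ?thesis
    by (simp add: stat_def sum_divide_distrib[symmetric])
qed

end

text \<open>\<open>\<mu>\<close> is the probability of a word of any length at consecutive times,
  and \<open>J\<close> is the lag counted positively. \<open>snoc\<close> is consistency in the last
  symbol; \<open>Cons\<close>, consistency in the first, is where stationarity enters.
  \<open>markov\<close> concerns only pasts of length at least \<open>d\<close>, as in
  \<open>stationary_chain\<close>.\<close>

locale lag_law = binary_kernel R for R +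
  fixes J d :: nat and \<mu> :: "bool list \<Rightarrow> real"
  assumes lag: "1 \<le> J" "J \<le> d"
    and nonneg: "0 \<le> \<mu> xs"
    and Nil: "\<mu> [] = 1"
    and snoc: "(\<Sum>a\<in>UNIV. \<mu> (xs @ [a])) = \<mu> xs"
    and Cons: "(\<Sum>a\<in>UNIV. \<mu> (a # xs)) = \<mu> xs"
    and markov: "d \<le> length xs \<Longrightarrow> \<mu> (xs @ [a]) = \<mu> xs * R (xs ! (length xs - J)) a"
begin

lemma sum_words: "(\<Sum>xs\<in>words m. \<mu> xs) = 1"
proof (induction m)
  case 0
  then show ?case unfolding sum_words_0 by (rule Nil)
next
  case (Suc m)
  then show ?case unfolding sum_words_snoc snoc .
qed

text \<open>Descending induction on the length, from \<open>d\<close> to \<open>J\<close>: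
  prepending a symbol does not change which symbol sits at lag \<open>J\<close>, and summing over
  the prepended symbol removes it again by \<open>Cons\<close>.\<close>

lemma markov_lag:
  assumes "J \<le> length xs"
  shows "\<mu> (xs @ [a]) = \<mu> xs * R (xs ! (length xs - J)) a"
proof -
  have "\<forall>xs. length xs = m \<longrightarrow> \<mu> (xs @ [a]) = \<mu> xs * R (xs ! (length xs - J)) a"
    if "J \<le> m" "m \<le> d" for m
    using that(2)
  proof (induction rule: inc_induct)
    case base
    then show ?case using markov by simp
  next
    case (step m')
    show ?case
    proof (intro allI impI)
      fix xs :: "bool list" assume len: "length xs = m'"
      have idx: "(b # xs) ! (length (b # xs) - J) = xs ! (length xs - J)" for b
        using len step.hyps that by (simp add: nth_Cons' Suc_diff_le)
      have "\<mu> (xs @ [a]) = (\<Sum>b\<in>UNIV. \<mu> ((b # xs) @ [a]))"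
        using Cons[of "xs @ [a]"] by simp
      also have "\<dots> = (\<Sum>b\<in>UNIV. \<mu> (b # xs) * R (xs ! (length xs - J)) a)"
        using step.IH len idx by (intro sum.cong) (auto simp del: append_Cons)
      also have "\<dots> = \<mu> xs * R (xs ! (length xs - J)) a"
        by (simp add: Cons sum_distrib_right[symmetric])
      finally show "\<mu> (xs @ [a]) = \<mu> xs * R (xs ! (length xs - J)) a" .
    qed
  qed
  then show ?thesis using assms markov by (cases "length xs \<le> d") auto
qed

text \<open>At lag \<open>J\<close> the process interleaves \<open>J\<close> independent two-state
  chains, so \<open>J\<close> consecutive symbols should be independent with law
  \<open>stat\<close>.\<close>

definition iid :: "bool list \<Rightarrow> real" where
  "iid xs = (\<Prod>a\<leftarrow>xs. stat a)"

lemma iid_simps [simp]: "iid [] = 1" "iid (a # xs) = stat a * iid xs" "iid (xs @ ys) = iid xs * iid ys"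
  by (simp_all add: iid_def)

lemma iid_pos: "0 < iid xs"
  by (induction xs) (simp_all add: stat_pos)

lemma sum_words_iid: "(\<Sum>xs\<in>words m. iid xs) = 1"
proof (induction m)
  case 0
  then show ?case by (simp only: sum_words_0 iid_simps)
next
  case (Suc m)
  then show ?case unfolding sum_words_snoc by (simp add: sum_distrib_left[symmetric] stat_sum)
qed

text \<open>Maximum principle: at lag \<open>J\<close>, both laws satisfy the same averaging identity for words of
  length \<open>J\<close>. If \<open>M\<close> is the maximal ratio, \<open>\<mu> - M * iid\<close> is nonpositive, and a zero at
  \<open>y @ [a]\<close> propagates to both words \<open>c # y\<close>; after \<open>J\<close> rotations it has reached every word.\<close>

lemma eq_iid_lag:
  assumes "length xs = J"
  shows "\<mu> xs = iid xs"
proof -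
  define M where "M = Max ((\<lambda>xs. \<mu> xs / iid xs) ` words J)"
  define e where "e xs = \<mu> xs - M * iid xs" for xs
  have ne: "words J \<noteq> {}" using assms by auto
  have "M \<in> (\<lambda>xs. \<mu> xs / iid xs) ` words J"
    unfolding M_def using ne finite_words by (intro Max_in) auto
  then obtain w where w: "length w = J" "M = \<mu> w / iid w" by auto
  have e_w: "e w = 0" using w iid_pos[of w] by (simp add: e_def)
  have e_le: "e xs \<le> 0" if "length xs = J" for xs
  proof -
    have "\<mu> xs / iid xs \<le> M"
      unfolding M_def using that finite_words by (intro Max_ge) auto
    then show ?thesis using iid_pos[of xs] by (simp add: e_def field_simps)
  qed
  have e_avg: "e (y @ [a]) = (\<Sum>c\<in>UNIV. e (c # y) * R c a)" if "Suc (length y) = J" for y a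
  proof -
    have "\<mu> (y @ [a]) = (\<Sum>c\<in>UNIV. \<mu> ((c # y) @ [a]))"
      using Cons[of "y @ [a]"] by simp
    also have "\<dots> = (\<Sum>c\<in>UNIV. \<mu> (c # y) * R c a)"
      using that by (intro sum.cong refl, subst markov_lag) auto
    finally have "\<mu> (y @ [a]) = (\<Sum>c\<in>UNIV. \<mu> (c # y) * R c a)" .
    moreover have "iid (y @ [a]) = (\<Sum>c\<in>UNIV. iid (c # y) * R c a)"
      by (simp add: stat_invariant[of a, symmetric] sum_distrib_left mult_ac)
    ultimately show ?thesis
      by (simp only: e_def left_diff_distrib sum_subtractf sum_distrib_left mult.assoc)
  qed
  have e_back: "e (c # y) = 0" if "Suc (length y) = J" "e (y @ [a]) = 0" for c y a
  proof -
    have "e (False # y) * R False a + e (True # y) * R True a = 0"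
      using e_avg[of y a] that by (simp add: UNIV_bool)
    moreover have "e (b # y) * R b a \<le> 0" for b
      using e_le[of "b # y"] R_pos[of b a] that by (simp add: mult_le_0_iff)
    ultimately have "e (c # y) * R c a = 0"
      by (cases c) (smt (verit))+
    then show ?thesis using R_pos[of c a] by simp
  qed
  have "i \<le> J \<longrightarrow> (\<forall>z. length z = i \<longrightarrow> e (z @ take (J - i) w) = 0)" for i
  proof (induction i)
    case 0
    then show ?case using e_w w by simp
  next
    case (Suc i)
    show ?case
    proof (intro impI allI)
      fix z :: "bool list" assume i: "Suc i \<le> J" and "length z = Suc i"
      then obtain c z' where z: "z = c # z'" "length z' = i" by (auto simp: length_Suc_conv)
      have "take (J - i) w = take (J - Suc i) w @ [w ! (J - Suc i)]"
        using i w take_Suc_conv_app_nth[of "J - Suc i" w] by (simp add: Suc_diff_Suc)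
      then have "e ((z' @ take (J - Suc i) w) @ [w ! (J - Suc i)]) = 0"
        using Suc.IH i z by simp
      then show "e (z @ take (J - Suc i) w) = 0"
        using e_back[of "z' @ take (J - Suc i) w"] z i w by simp
    qed
  qed
  from this[of J] have e_zero: "e z = 0" if "length z = J" for z using that by simp
  \<comment> \<open>The two laws are now proportional, and both have total mass one, which fixes the
    constant.\<close>
  have "(\<Sum>xs\<in>words J. \<mu> xs) = (\<Sum>xs\<in>words J. M * iid xs)"
    using e_zero by (intro sum.cong) (auto simp: e_def)
  then have "M = 1"
    by (simp add: sum_words sum_words_iid sum_distrib_left[symmetric])
  then show ?thesis using e_zero[OF assms] by (simp add: e_def)
qed

text \<open>Shorter words are marginals of words of length \<open>J\<close>; both laws lose their
  first symbol in the same way.\<close>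

lemma eq_iid:
  assumes "length xs \<le> J"
  shows "\<mu> xs = iid xs"
proof -
  have "\<forall>xs. length xs = m \<longrightarrow> \<mu> xs = iid xs" if "m \<le> J" for m
    using that
  proof (induction rule: inc_induct)
    case base
    then show ?case using eq_iid_lag by simp
  next
    case (step m')
    show ?case
    proof (intro allI impI)
      fix xs :: "bool list" assume "length xs = m'"
      then have "\<mu> xs = (\<Sum>a\<in>UNIV. iid (a # xs))"
        using step.IH Cons[of xs] by simp
      then show "\<mu> xs = iid xs"
        by (simp add: sum_distrib_right[symmetric] stat_sum)
    qed
  qed
  then show ?thesis using assms by blast
qed

text \<open>The law of the next symbol given a past of any length. While lag \<open>J\<close>
  reaches back before the start of the word, the next symbol is independent of the past.\<close>

definition cond :: "bool list \<Rightarrow> bool \<Rightarrow> real" where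
  "cond xs a = (if J \<le> length xs then R (xs ! (length xs - J)) a else stat a)"

lemma snoc_cond: "\<mu> (xs @ [a]) = \<mu> xs * cond xs a"
  by (auto simp: cond_def markov_lag eq_iid)

lemma cond_pos: "0 < cond xs a"
  by (simp add: cond_def R_pos stat_pos)

lemma cond_sum: "(\<Sum>a\<in>UNIV. cond xs a) = 1"
  by (cases "J \<le> length xs") (simp_all add: cond_def R_sum stat_sum)

lemma pos: "0 < \<mu> xs"
  by (induction xs rule: rev_induct) (simp_all add: Nil snoc_cond cond_pos)

text \<open>Every single symbol has law \<open>stat\<close>: \<open>Cons\<close> strips the symbols
  before position \<open>p\<close>, \<open>snoc\<close> those after it, and the remaining one-letter
  words are covered by \<open>eq_iid\<close> because \<open>1 \<le> J\<close>.\<close>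

lemma sum_words_nth:
  assumes "p < m"
  shows "(\<Sum>xs\<in>words m. \<mu> xs * F (xs ! p)) = (\<Sum>a\<in>UNIV. stat a * F a)"
proof -
  have first: "(\<Sum>xs\<in>words (Suc m). \<mu> xs * F (xs ! 0)) = (\<Sum>a\<in>UNIV. stat a * F a)" for m
  proof (induction m)
    case 0
    show ?case
      unfolding sum_words_Cons sum_words_0 using lag by (simp add: eq_iid)
  next
    case (Suc m)
    have "(\<Sum>xs\<in>words (Suc (Suc m)). \<mu> xs * F (xs ! 0))
        = (\<Sum>ys\<in>words (Suc m). \<Sum>a\<in>UNIV. \<mu> (ys @ [a]) * F (ys ! 0))"
      unfolding sum_words_snoc[of _ "Suc m"] by (intro sum.cong) (auto simp: nth_append)
    also have "\<dots> = (\<Sum>ys\<in>words (Suc m). \<mu> ys * F (ys ! 0))"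
      by (simp only: sum_distrib_right[symmetric] snoc)
    finally show ?case using Suc.IH by simp
  qed
  show ?thesis
    using assms
  proof (induction m arbitrary: p)
    case (Suc m)
    show ?case
    proof (cases p)
      case 0
      then show ?thesis using first by simp
    next
      case (Suc p')
      have "(\<Sum>xs\<in>words (Suc m). \<mu> xs * F (xs ! p))
          = (\<Sum>ys\<in>words m. \<Sum>a\<in>UNIV. \<mu> (a # ys) * F (ys ! p'))"
        unfolding sum_words_Cons Suc by simp
      also have "\<dots> = (\<Sum>ys\<in>words m. \<mu> ys * F (ys ! p'))"
        by (simp only: sum_distrib_right[symmetric] Cons)
      finally show ?thesis using Suc.IH[of p'] Suc.prems Suc by simp
    qed
  qed simp
qed

text \<open>After truncation at the later position \<open>q\<close>, disagreement forces the last
  symbol to be the negation of the one at \<open>p\<close>; given any past, this has probability at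
  most \<open>u\<close>.\<close>

lemma sum_words_nth_neq:
  assumes "p < q" "q < m" and u: "\<And>xs a. cond xs a \<le> u"
  shows "(\<Sum>xs\<in>words m. \<mu> xs * of_bool (xs ! p \<noteq> xs ! q)) \<le> u"
  using assms(2)
proof (induction m)
  case (Suc m)
  show ?case
  proof (cases "q < m")
    case True
    have "(\<Sum>xs\<in>words (Suc m). \<mu> xs * of_bool (xs ! p \<noteq> xs ! q))
        = (\<Sum>ys\<in>words m. \<Sum>a\<in>UNIV. \<mu> (ys @ [a]) * of_bool (ys ! p \<noteq> ys ! q))"
      unfolding sum_words_snoc using True assms(1) by (intro sum.cong) (auto simp: nth_append)
    also have "\<dots> = (\<Sum>ys\<in>words m. \<mu> ys * of_bool (ys ! p \<noteq> ys ! q))"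
      by (simp only: sum_distrib_right[symmetric] snoc)
    finally show ?thesis using Suc.IH True by simp
  next
    case False
    then have q: "q = m" using Suc.prems by simp
    have "(\<Sum>xs\<in>words (Suc m). \<mu> xs * of_bool (xs ! p \<noteq> xs ! q))
        = (\<Sum>ys\<in>words m. \<mu> ys * cond ys (\<not> ys ! p))"
      unfolding sum_words_snoc
    proof (intro sum.cong refl)
      fix ys assume "ys \<in> words m"
      then show "(\<Sum>a\<in>UNIV. \<mu> (ys @ [a]) * of_bool ((ys @ [a]) ! p \<noteq> (ys @ [a]) ! q))
          = \<mu> ys * cond ys (\<not> ys ! p)"
        using assms(1) q by (cases "ys ! p") (simp_all add: nth_append UNIV_bool snoc_cond)
    qed
    also have "\<dots> \<le> (\<Sum>ys\<in>words m. \<mu> ys * u)"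
      using u nonneg by (intro sum_mono mult_left_mono) auto
    also have "\<dots> = u" by (simp add: sum_distrib_right[symmetric] sum_words)
    finally show ?thesis .
  qed
qed simp

end

section \<open>Comparing two lags\<close>

text \<open>The bound \<open>ln t \<le> t - 1\<close> in each term; the right-hand side is the
  chi-square divergence of two Bernoulli laws.\<close>

lemma binary_KL_le_chi2:
  fixes c c' :: real
  assumes "0 < c" "c < 1" "0 < c'" "c' < 1"
  shows "c * ln (c / c') + (1 - c) * ln ((1 - c) / (1 - c')) \<le> (c - c')\<^sup>2 / (c' * (1 - c'))"
proof -
  have "c * ln (c / c') \<le> c * (c / c' - 1)"
    using assms by (intro mult_left_mono ln_le_minus_one) auto
  moreover have "(1 - c) * ln ((1 - c) / (1 - c')) \<le> (1 - c) * ((1 - c) / (1 - c') - 1)"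
    using assms by (intro mult_left_mono ln_le_minus_one) auto
  moreover have "c * (c / c' - 1) + (1 - c) * ((1 - c) / (1 - c') - 1) = (c - c')\<^sup>2 / (c' * (1 - c'))"
    using assms by (simp add: field_simps power2_eq_square)
  ultimately show ?thesis by linarith
qed

text \<open>The two laws share the kernel, hence the invariant law; only their lags may
  differ.\<close>

locale lag_pair = fst: lag_law R J d \<mu> + snd: lag_law R K d \<nu>
  for R J K d \<mu> \<nu> +
  fixes lam :: real
  assumes lam: "0 < lam" "lam < 1"
    and R_ge: "(1 - lam) / 2 \<le> R b a"
begin

lemma R_le: "R b a \<le> (1 + lam) / 2"
  using R_ge[of b "\<not> a"] fst.R_False[of b] by (cases a) (auto simp: field_simps)

lemma stat_bounds: "(1 - lam) / 2 \<le> fst.stat a" "fst.stat a \<le> (1 + lam) / 2"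
proof -
  have "(\<Sum>c\<in>UNIV. fst.stat c * ((1 - lam) / 2)) \<le> (\<Sum>c\<in>UNIV. fst.stat c * R c a)"
    using R_ge fst.stat_pos by (intro sum_mono mult_left_mono) (auto intro: less_imp_le)
  then show "(1 - lam) / 2 \<le> fst.stat a"
    unfolding fst.stat_invariant sum_distrib_right[symmetric] fst.stat_sum by simp
  have "(\<Sum>c\<in>UNIV. fst.stat c * R c a) \<le> (\<Sum>c\<in>UNIV. fst.stat c * ((1 + lam) / 2))"
    using R_le fst.stat_pos by (intro sum_mono mult_left_mono) (auto intro: less_imp_le)
  then show "fst.stat a \<le> (1 + lam) / 2"
    unfolding fst.stat_invariant sum_distrib_right[symmetric] fst.stat_sum by simp
qed

lemma cond_bounds:
  "fst.cond xs a \<le> (1 + lam) / 2" "(1 - lam) / 2 \<le> snd.cond xs a" "snd.cond xs a \<le> (1 + lam) / 2"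
  by (auto simp only: fst.cond_def snd.cond_def R_ge R_le stat_bounds split: if_splits)

lemma step_KL_le:
  "(\<Sum>a\<in>UNIV. fst.cond xs a * ln (fst.cond xs a / snd.cond xs a))
    \<le> 4 / (1 - lam\<^sup>2) * (fst.cond xs True - snd.cond xs True)\<^sup>2"
proof -
  define c c' where "c = fst.cond xs True" and "c' = snd.cond xs True"
  have F: "fst.cond xs False = 1 - c" "snd.cond xs False = 1 - c'"
    using fst.cond_sum[of xs] snd.cond_sum[of xs] by (simp_all add: UNIV_bool c_def c'_def)
  have pos: "0 < c" "c < 1" "0 < c'" "c' < 1"
    using fst.cond_pos[of xs] snd.cond_pos[of xs] F unfolding c_def c'_def
    by (metis diff_gt_0_iff_gt)+
  \<comment> \<open>The endpoints of the range of \<open>c'\<close> add up to 1, so this product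
    equals \<open>c' * (1 - c')\<close> minus the Bernoulli variance at an endpoint.\<close>
  have "0 \<le> (c' - (1 - lam) / 2) * ((1 + lam) / 2 - c')"
    using cond_bounds(2,3)[of xs True] by (intro mult_nonneg_nonneg) (auto simp: c'_def)
  then have var: "(1 - lam\<^sup>2) / 4 \<le> c' * (1 - c')"
    by (simp add: field_simps power2_eq_square)
  have lam2: "0 < 1 - lam\<^sup>2"
    using lam by (simp add: power_less_one_iff abs_square_less_1)
  have "(\<Sum>a\<in>UNIV. fst.cond xs a * ln (fst.cond xs a / snd.cond xs a))
      \<le> (c - c')\<^sup>2 / (c' * (1 - c'))"
    using binary_KL_le_chi2[OF pos] by (simp add: UNIV_bool F c_def[symmetric] c'_def[symmetric])
  also have "\<dots> \<le> (c - c')\<^sup>2 / ((1 - lam\<^sup>2) / 4)"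
    using var lam2 by (intro divide_left_mono) (auto intro: mult_pos_pos pos)
  finally show ?thesis by (simp add: c_def c'_def mult.commute)
qed

text \<open>The total variation distance between the two rows of \<open>R\<close>; for
  \<open>lag_kernel\<close> it is the \<open>\<delta>\<close> of the theorem.\<close>

definition gap :: real where
  "gap = \<bar>R True True - R False True\<bar>"

text \<open>The left-hand side is the variance of \<open>R a True\<close> under the invariant law,
  which is exactly \<open>s * (1 - s)\<close> times the squared gap. The bound is deliberately
  loose, to match the case of two visible lags.\<close>

lemma stat_deviation:
  "(\<Sum>a\<in>UNIV. fst.stat a * (R a True - fst.stat True)\<^sup>2) \<le> (1 + lam) / 2 * gap\<^sup>2"
proof -
  define s where "s = fst.stat True"
  have sF: "fst.stat False = 1 - s"
    using fst.stat_sum by (simp add: UNIV_bool s_def)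
  have inv: "s = (1 - s) * R False True + s * R True True"
    using fst.stat_invariant[of True] by (simp add: UNIV_bool sF s_def)
  have "R True True - s = (1 - s) * (R True True - R False True)"
    using inv by (simp add: algebra_simps)
  moreover have "R False True - s = - (s * (R True True - R False True))"
    using inv by (simp add: algebra_simps)
  ultimately have "(\<Sum>a\<in>UNIV. fst.stat a * (R a True - fst.stat True)\<^sup>2) = s * (1 - s) * gap\<^sup>2"
    by (simp add: UNIV_bool sF s_def[symmetric] gap_def power_mult_distrib)
       (simp add: power2_eq_square algebra_simps)
  moreover have "s * (1 - s) \<le> (1 + lam) / 2"
    using lam sum_squares_ge_zero[of "s - 1/2" 0] by (simp add: field_simps power2_eq_square)
  ultimately show ?thesis by (simp only: mult_right_mono zero_le_power2)
qed

text \<open>The factor \<open>(1 + lam) / 2\<close> compensates the loss of \<open>1 / (1 + lam)\<close> in \<open>step_KL_le\<close>: whatever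
  the past, no symbol has conditional probability above \<open>(1 + lam) / 2\<close>, so the symbols at the two
  lags differ with at most that probability.\<close>

lemma cond_deviation:
  "(\<Sum>xs\<in>words m. \<mu> xs * (fst.cond xs True - snd.cond xs True)\<^sup>2) \<le> (1 + lam) / 2 * gap\<^sup>2"
proof -
  \<comment> \<open>With no lag visible, or equal lags, the conditional laws agree. With one
    visible, a row of \<open>R\<close> is compared with \<open>stat\<close>; with two, a row with a
    row.\<close>
  consider "m < J" "m < K" | "J \<le> m" "m < K" | "m < J" "K \<le> m" | "J = K" | "J \<le> m" "K \<le> m" "J \<noteq> K"
    by linarith
  then show ?thesis
  proof cases
    case 1
    have "(\<Sum>xs\<in>words m. \<mu> xs * (fst.cond xs True - snd.cond xs True)\<^sup>2) = 0"
      using 1 by (intro sum.neutral) (auto simp: fst.cond_def snd.cond_def)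
    then show ?thesis using lam by simp
  next
    case 2
    have "(\<Sum>xs\<in>words m. \<mu> xs * (fst.cond xs True - snd.cond xs True)\<^sup>2)
        = (\<Sum>xs\<in>words m. \<mu> xs * (R (xs ! (m - J)) True - fst.stat True)\<^sup>2)"
      using 2 by (intro sum.cong) (auto simp: fst.cond_def snd.cond_def)
    also have "\<dots> = (\<Sum>a\<in>UNIV. fst.stat a * (R a True - fst.stat True)\<^sup>2)"
      using 2 fst.lag by (intro fst.sum_words_nth) auto
    finally show ?thesis using stat_deviation by simp
  next
    case 3
    have "(\<Sum>xs\<in>words m. \<mu> xs * (fst.cond xs True - snd.cond xs True)\<^sup>2)
        = (\<Sum>xs\<in>words m. \<mu> xs * (R (xs ! (m - K)) True - fst.stat True)\<^sup>2)"
      using 3 by (intro sum.cong) (auto simp: fst.cond_def snd.cond_def power2_commute)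
    \<comment> \<open>The position is determined by the lag of \<open>\<nu>\<close>, but the average
      is under \<open>\<mu>\<close>; each single symbol has law \<open>stat\<close> there
      too.\<close>
    also have "\<dots> = (\<Sum>a\<in>UNIV. fst.stat a * (R a True - fst.stat True)\<^sup>2)"
      using 3 snd.lag by (intro fst.sum_words_nth) auto
    finally show ?thesis using stat_deviation by simp
  next
    case 4
    have "(\<Sum>xs\<in>words m. \<mu> xs * (fst.cond xs True - snd.cond xs True)\<^sup>2) = 0"
      using 4 by (intro sum.neutral) (auto simp: fst.cond_def snd.cond_def)
    then show ?thesis using lam by simp
  next
    case 5
    define p q where "p = m - J" and "q = m - K"
    have pq: "p < m" "q < m" "p < q \<or> q < p"
      using 5 fst.lag snd.lag by (auto simp: p_def q_def)
    have gap2: "(R b True - R c True)\<^sup>2 = of_bool (b \<noteq> c) * gap\<^sup>2" for b c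
      by (cases b; cases c) (simp_all add: gap_def power2_commute)
    have "(\<Sum>xs\<in>words m. \<mu> xs * (fst.cond xs True - snd.cond xs True)\<^sup>2)
        = (\<Sum>xs\<in>words m. \<mu> xs * of_bool (xs ! p \<noteq> xs ! q) * gap\<^sup>2)"
      using 5 by (intro sum.cong) (auto simp: fst.cond_def snd.cond_def gap2 p_def q_def)
    also have "\<dots> = (\<Sum>xs\<in>words m. \<mu> xs * of_bool (xs ! p \<noteq> xs ! q)) * gap\<^sup>2"
      by (simp only: sum_distrib_right)
    also have "\<dots> \<le> (1 + lam) / 2 * gap\<^sup>2"
      using pq fst.sum_words_nth_neq[of p q m, OF _ _ cond_bounds(1)]
        fst.sum_words_nth_neq[of q p m, OF _ _ cond_bounds(1)]
      by (intro mult_right_mono) (auto simp: eq_commute[of "_ ! p"])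
    finally show ?thesis .
  qed
qed

text \<open>Chain rule: the log-ratio of \<open>xs @ [a]\<close> is that of \<open>xs\<close> plus
  that of the conditional laws, so each new symbol adds at most
  \<open>2 * gap\<^sup>2 / (1 - lam)\<close>.\<close>

lemma KL_words_le:
  "(\<Sum>xs\<in>words m. \<mu> xs * ln (\<mu> xs / \<nu> xs)) \<le> 2 * real m * gap\<^sup>2 / (1 - lam)"
proof (induction m)
  case 0
  then show ?case unfolding sum_words_0 by (simp add: fst.Nil snd.Nil)
next
  case (Suc m)
  have split: "(\<Sum>a\<in>UNIV. \<mu> (xs @ [a]) * ln (\<mu> (xs @ [a]) / \<nu> (xs @ [a])))
      = \<mu> xs * ln (\<mu> xs / \<nu> xs)
        + \<mu> xs * (\<Sum>a\<in>UNIV. fst.cond xs a * ln (fst.cond xs a / snd.cond xs a))" for xs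
  proof -
    have "ln (\<mu> (xs @ [a]) / \<nu> (xs @ [a])) = ln (\<mu> xs / \<nu> xs) + ln (fst.cond xs a / snd.cond xs a)"
      for a
      using fst.pos[of xs] snd.pos[of xs] fst.cond_pos[of xs a] snd.cond_pos[of xs a]
      by (simp add: fst.snoc_cond snd.snoc_cond ln_mult ln_div)
    then have "(\<Sum>a\<in>UNIV. \<mu> (xs @ [a]) * ln (\<mu> (xs @ [a]) / \<nu> (xs @ [a])))
        = (\<Sum>a\<in>UNIV. \<mu> (xs @ [a])) * ln (\<mu> xs / \<nu> xs)
          + (\<Sum>a\<in>UNIV. \<mu> xs * (fst.cond xs a * ln (fst.cond xs a / snd.cond xs a)))"
      by (simp add: distrib_left sum.distrib sum_distrib_right fst.snoc_cond mult.assoc)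
    then show ?thesis by (simp only: fst.snoc sum_distrib_left)
  qed
  have "(\<Sum>xs\<in>words m. \<mu> xs * (\<Sum>a\<in>UNIV. fst.cond xs a * ln (fst.cond xs a / snd.cond xs a)))
      \<le> (\<Sum>xs\<in>words m. \<mu> xs * (4 / (1 - lam\<^sup>2) * (fst.cond xs True - snd.cond xs True)\<^sup>2))"
    using fst.nonneg by (intro sum_mono mult_left_mono step_KL_le) auto
  also have "\<dots> = 4 / (1 - lam\<^sup>2) * (\<Sum>xs\<in>words m. \<mu> xs * (fst.cond xs True - snd.cond xs True)\<^sup>2)"
    unfolding sum_distrib_left by (intro sum.cong) auto
  also have "\<dots> \<le> 4 / (1 - lam\<^sup>2) * ((1 + lam) / 2 * gap\<^sup>2)"
    using lam by (intro mult_left_mono cond_deviation) (simp add: power_le_one)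
  also have "1 - lam\<^sup>2 = (1 - lam) * (1 + lam)"
    by (simp add: power2_eq_square algebra_simps)
  also have "4 / ((1 - lam) * (1 + lam)) * ((1 + lam) / 2 * gap\<^sup>2) = 2 * gap\<^sup>2 / (1 - lam)"
    using lam by (simp add: divide_simps)
  finally show ?case
    using Suc.IH unfolding sum_words_snoc split sum.distrib
    by (simp add: add_divide_distrib algebra_simps)
qed

end

section \<open>A change-of-measure inequality\<close>

text \<open>The Donsker--Varadhan inequality for the test function \<open>ln c * indicator A\<close>, whose
  exponential moment under \<open>Q\<close> is at most 2.\<close>

lemma prob_mult_ln_le_KL:
  fixes P Q :: "'b \<Rightarrow> real" and c :: real
  assumes fin: "finite S" and A: "A \<subseteq> S" and c: "0 < c"
    and pos: "\<And>x. x \<in> S \<Longrightarrow> 0 < P x" "\<And>x. x \<in> S \<Longrightarrow> 0 < Q x"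
    and sums: "sum P S = 1" "sum Q S = 1"
    and small: "sum Q A \<le> 1 / c"
  shows "sum P A * ln c \<le> (\<Sum>x\<in>S. P x * ln (P x / Q x)) + ln 2"
proof -
  define w where "w x = (if x \<in> A then c else 1)" for x
  have restrict: "(\<Sum>x\<in>S. if x \<in> A then g x else 0) = sum g A" for g :: "'b \<Rightarrow> real"
    using fin A by (simp add: sum.If_cases Int_absorb1)
  \<comment> \<open>Here \<open>w\<close> is the exponential of the test function. Dividing by 2,
    the bound on its \<open>Q\<close>-mean, makes the right-hand sides sum to at most 0.\<close>
  have "P x * ln (w x) - P x * ln (P x / Q x) - P x * ln 2 \<le> Q x * w x / 2 - P x" if "x \<in> S" for x
  proof -
    have w: "0 < w x" using c by (simp add: w_def)
    have "P x * ln (w x) - P x * ln (P x / Q x) - P x * ln 2 = P x * ln (Q x * w x / (2 * P x))"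
      using pos[OF that] w by (simp add: ln_mult ln_div algebra_simps)
    also have "\<dots> \<le> P x * (Q x * w x / (2 * P x) - 1)"
      using pos[OF that] w by (intro mult_left_mono ln_le_minus_one) auto
    also have "\<dots> = Q x * w x / 2 - P x"
      using pos[OF that] by (simp add: field_simps)
    finally show ?thesis .
  qed
  then have "(\<Sum>x\<in>S. P x * ln (w x) - P x * ln (P x / Q x) - P x * ln 2)
      \<le> (\<Sum>x\<in>S. Q x * w x / 2 - P x)"
    by (rule sum_mono)
  moreover have "(\<Sum>x\<in>S. P x * ln (w x)) = sum P A * ln c"
  proof -
    have "(\<Sum>x\<in>S. P x * ln (w x)) = (\<Sum>x\<in>S. if x \<in> A then P x * ln c else 0)"
      by (intro sum.cong) (auto simp: w_def)
    then show ?thesis by (simp add: restrict sum_distrib_right)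
  qed
  moreover have "(\<Sum>x\<in>S. Q x * w x) \<le> 2"
  proof -
    have "(\<Sum>x\<in>S. Q x * w x) \<le> (\<Sum>x\<in>S. (if x \<in> A then Q x * c else 0) + Q x)"
      using pos(2) by (intro sum_mono) (auto simp: w_def intro: less_imp_le)
    also have "\<dots> = sum Q A * c + 1"
      by (simp add: sum.distrib restrict sum_distrib_right sums)
    finally show ?thesis using small c by (simp add: field_simps)
  qed
  ultimately show ?thesis
    by (simp add: sum_subtractf sum_distrib_right[symmetric] sum_divide_distrib[symmetric] sums)
qed

section \<open>Word probabilities of a stationary chain\<close>

lemma sample_0: "sample 0 X = []"
  by (simp add: sample_def)

lemma sample_Suc: "sample (Suc m) X = sample m X @ [X (1 + int m)]"
  using upto_rec2[of 1 "1 + int m"] by (simp add: sample_def add.commute)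

lemma sample_Suc_shift: "sample (Suc m) X = X 1 # sample m (\<lambda>t. X (t + 1))"
  by (induction m) (simp_all add: sample_0 sample_Suc add.commute)

text \<open>Rewrites a sample event as the window event of \<open>stationary_chain\<close> before
  time \<open>1 + int m\<close>; times start at 1 and list positions at 0.\<close>

lemma sample_eq_iff:
  "sample m X = xs \<longleftrightarrow> length xs = m \<and> (\<forall>i\<in>{1..<1 + int m}. X i = xs ! nat (i - 1))"
proof (induction m arbitrary: xs)
  case 0
  then show ?case by (auto simp: sample_0)
next
  case (Suc m)
  show ?case
  proof (cases xs rule: rev_cases)
    case Nil
    then show ?thesis by (simp add: sample_Suc)
  next
    case (snoc ys a)
    have split: "{1..<1 + int (Suc m)} = insert (1 + int m) {1..<1 + int m}" by auto
    have "(\<forall>i\<in>{1..<1 + int m}. X i = (ys @ [a]) ! nat (i - 1))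
        \<longleftrightarrow> (\<forall>i\<in>{1..<1 + int m}. X i = ys ! nat (i - 1))" if "length ys = m"
      using that by (intro ball_cong refl) (auto simp: nth_append)
    then show ?thesis
      unfolding snoc split by (auto simp: sample_Suc Suc.IH nth_append)
  qed
qed

locale path_law = prob_space M for M :: "(int \<Rightarrow> bool) measure" +
  assumes sets_M [measurable_cong]: "sets M = sets path_space"
begin

lemma space_M: "space M = UNIV"
  using sets_eq_imp_space_eq[OF sets_M] by (simp add: space_PiM)

lemma coordinate [measurable]: "(\<lambda>X. X t) \<in> measurable M (count_space UNIV)"
  unfolding measurable_cong_sets[OF sets_M refl] by (rule measurable_component_singleton) simp

lemma sample_measurable [measurable]: "Measurable.pred M (\<lambda>X. sample m X = xs)"
  unfolding sample_eq_iff by measurable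

lemma prob_split:
  assumes [measurable]: "Measurable.pred M Q"
  shows "(\<Sum>a\<in>UNIV. \<P>(X in M. Q X \<and> X t = a)) = \<P>(X in M. Q X)"
proof -
  have "\<P>(X in M. Q X \<and> \<not> X t) + \<P>(X in M. Q X \<and> X t)
      = prob ({X \<in> space M. Q X \<and> \<not> X t} \<union> {X \<in> space M. Q X \<and> X t})"
    by (rule finite_measure_Union[symmetric]) auto
  also have "{X \<in> space M. Q X \<and> \<not> X t} \<union> {X \<in> space M. Q X \<and> X t} = {X \<in> space M. Q X}"
    by auto
  finally show ?thesis by (simp add: UNIV_bool)
qed

lemma prob_sample_pred:
  "\<P>(X in M. H (sample n X)) = (\<Sum>xs\<in>{xs\<in>words n. H xs}. sample_prob n M xs)"
proof -
  have "{X \<in> space M. H (sample n X)}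
      = (\<Union>xs\<in>{xs\<in>words n. H xs}. {X \<in> space M. sample n X = xs})"
    by (auto simp: sample_def)
  then show ?thesis
    unfolding sample_prob_def using finite_words[of n]
    by (simp only:) (intro finite_measure_finite_Union; auto simp: disjoint_family_on_def)
qed

end

section \<open>Single-lag chains as instances of \<open>lag_law\<close>\<close>

definition lag_kernel :: "real \<Rightarrow> (bool \<Rightarrow> bool pmf) \<Rightarrow> bool \<Rightarrow> bool \<Rightarrow> real" where
  "lag_kernel lam q b a = (let r = (1 - lam) / 2 + lam * pmf (q b) True in if a then r else 1 - r)"

lemma lag_kernel_ge:
  assumes "0 < lam" "lam < 1"
  shows "(1 - lam) / 2 \<le> lag_kernel lam q b a"
proof -
  have "0 \<le> lam * pmf (q b) True" "lam * pmf (q b) True \<le> lam"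
    using assms by (auto intro: mult_left_le pmf_le_1)
  then show ?thesis by (simp add: lag_kernel_def Let_def field_simps)
qed

lemma single_lag_eq: "single_lag lam q j a x = lag_kernel lam q (x j) a"
  by (simp add: single_lag_def lag_kernel_def)

lemma binary_kernel_lag_kernel:
  assumes "0 < lam" "lam < 1"
  shows "binary_kernel (lag_kernel lam q)"
proof
  show "0 < lag_kernel lam q b a" for b a
    using lag_kernel_ge[OF assms, of q b a] assms by simp
  show "(\<Sum>a\<in>UNIV. lag_kernel lam q b a) = 1" for b
    by (simp add: lag_kernel_def Let_def UNIV_bool)
qed

lemma path_law_stationary_chain:
  assumes "stationary_chain d p M"
  shows "path_law M"
  using assms by (simp add: path_law_def path_law_axioms_def stationary_chain_def)

text \<open>The bridge from measures on paths to word probabilities. It holds for every law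
  satisfying \<open>stationary_chain\<close>, so no choice of such a law has to be singled
  out.\<close>

lemma lag_law_sample_prob:
  assumes lam: "0 < lam" "lam < 1" and j: "j \<in> lags d"
    and chain: "stationary_chain d (single_lag lam q j) M"
  shows "lag_law (lag_kernel lam q) (nat (- j)) d (\<lambda>xs. sample_prob (length xs) M xs)"
proof -
  interpret path_law M using path_law_stationary_chain[OF chain] .
  interpret binary_kernel "lag_kernel lam q" using binary_kernel_lag_kernel[OF lam] .
  show ?thesis
  proof
    show "1 \<le> nat (- j)" "nat (- j) \<le> d" using j by (auto simp: lags_def)
    show "0 \<le> sample_prob (length xs) M xs" for xs
      by (simp add: sample_prob_def)
    show "sample_prob (length []) M [] = 1"
      using prob_space by (simp add: sample_prob_def sample_0)
  next
    fix xs :: "bool list"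
    have "(\<Sum>a\<in>UNIV. sample_prob (length (xs @ [a])) M (xs @ [a]))
        = (\<Sum>a\<in>UNIV. \<P>(X in M. sample (length xs) X = xs \<and> X (1 + int (length xs)) = a))"
      by (simp add: sample_prob_def sample_Suc)
    then show "(\<Sum>a\<in>UNIV. sample_prob (length (xs @ [a])) M (xs @ [a])) = sample_prob (length xs) M xs"
      by (simp add: prob_split sample_prob_def)
  next
    fix xs :: "bool list"
    let ?T = "\<lambda>(X :: int \<Rightarrow> bool) t. X (t + 1)"
    have T [measurable]: "?T \<in> measurable M path_space"
      by (rule measurable_PiM_single') (auto simp: coordinate)
    \<comment> \<open>Invariance under the shift by one moves the word to times 2 and later, which
      frees time 1 for the prepended symbol.\<close>
    have shifted: "distr M path_space ?T = M"
      using chain by (simp add: stationary_chain_def)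
    have "{X \<in> space M. sample (length xs) X = xs} \<in> sets M"
      by measurable
    then have "{X \<in> space M. sample (length xs) X = xs} \<in> sets path_space"
      by (simp only: sets_M)
    from measure_distr[OF T this]
    have "sample_prob (length xs) M xs
        = prob (?T -` {X \<in> space M. sample (length xs) X = xs} \<inter> space M)"
      by (simp only: shifted sample_prob_def)
    also have "?T -` {X \<in> space M. sample (length xs) X = xs} \<inter> space M
        = {X \<in> space M. sample (length xs) (?T X) = xs}"
      by (auto simp: space_M)
    also have "prob \<dots> = (\<Sum>a\<in>UNIV. \<P>(X in M. sample (length xs) (?T X) = xs \<and> X 1 = a))"
    proof (rule prob_split[symmetric])
      have "Measurable.pred path_space (\<lambda>X. sample (length xs) X = xs)"
        using sample_measurable unfolding measurable_cong_sets[OF sets_M refl] .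
      then show "Measurable.pred M (\<lambda>X. sample (length xs) (?T X) = xs)"
        by (rule measurable_compose[OF T])
    qed
    also have "\<dots> = (\<Sum>a\<in>UNIV. sample_prob (length (a # xs)) M (a # xs))"
      by (simp add: sample_prob_def sample_Suc_shift conj_commute)
    finally show "(\<Sum>a\<in>UNIV. sample_prob (length (a # xs)) M (a # xs)) = sample_prob (length xs) M xs"
      by simp
  next
    fix xs :: "bool list" and a
    assume long: "d \<le> length xs"
    define t where "t = 1 + int (length xs)"
    define x where "x i = xs ! nat (i - 1)" for i :: int
    have window: "sample (length xs) X = xs \<longleftrightarrow> (\<forall>i\<in>{t - int (length xs)..<t}. X i = x i)" for X
      by (simp add: sample_eq_iff t_def x_def)
    have snoc: "sample_prob (length (xs @ [a])) M (xs @ [a])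
        = \<P>(X in M. X t = a \<and> sample (length xs) X = xs)"
      by (simp add: sample_prob_def sample_Suc t_def conj_commute)
    show "sample_prob (length (xs @ [a])) M (xs @ [a])
        = sample_prob (length xs) M xs * lag_kernel lam q (xs ! (length xs - nat (- j))) a"
    \<comment> \<open>Conditional probabilities are prescribed only for pasts of positive
      probability; for a null past both sides vanish.\<close>
    proof (cases "sample_prob (length xs) M xs = 0")
      case True
      have "sample_prob (length (xs @ [a])) M (xs @ [a]) \<le> sample_prob (length xs) M xs"
        unfolding snoc unfolding sample_prob_def by (intro finite_measure_mono) auto
      then show ?thesis
        using True by (simp add: sample_prob_def antisym)
    next
      case False
      then have "\<P>(X in M. \<forall>i\<in>{t - int (length xs)..<t}. X i = x i) > 0"
        by (simp add: sample_prob_def window zero_less_measure_iff)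
      then have "\<P>(X in M. X t = a \<bar> \<forall>i\<in>{t - int (length xs)..<t}. X i = x i)
          = single_lag lam q j a (\<lambda>i. x (t + i))"
        using chain long by (simp add: stationary_chain_def)
      moreover have "nat (t + j - 1) = length xs - nat (- j)"
        using j long by (auto simp: t_def lags_def)
      ultimately have "\<P>(X in M. X t = a \<bar> sample (length xs) X = xs)
          = lag_kernel lam q (xs ! (length xs - nat (- j))) a"
        by (simp add: window single_lag_eq x_def)
      then show ?thesis
        using False unfolding snoc cond_prob_def by (simp add: sample_prob_def field_simps)
    qed
  qed
qed

section \<open>Kullback-Leibler bound and lag estimation\<close>

lemma lag_pair_sample_prob:
  assumes "0 < lam" "lam < 1" "j \<in> lags d" "k \<in> lags d"
    and "stationary_chain d (single_lag lam q j) Mj" "stationary_chain d (single_lag lam q k) Mk"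
  shows "lag_pair (lag_kernel lam q) (nat (- j)) (nat (- k)) d
    (\<lambda>xs. sample_prob (length xs) Mj xs) (\<lambda>xs. sample_prob (length xs) Mk xs) lam"
  unfolding lag_pair_def lag_pair_axioms_def
  using assms by (intro conjI allI lag_law_sample_prob lag_kernel_ge)

lemma sample_prob_pos:
  assumes "0 < lam" "lam < 1" "j \<in> lags d" "stationary_chain d (single_lag lam q j) M"
    and "length xs = n"
  shows "0 < sample_prob n M xs"
  using lag_law.pos[OF lag_law_sample_prob[OF assms(1-4)], of xs] assms(5) by simp

lemma sum_sample_prob:
  assumes "0 < lam" "lam < 1" "j \<in> lags d" "stationary_chain d (single_lag lam q j) M"
  shows "(\<Sum>xs\<in>words n. sample_prob n M xs) = 1"
proof -
  have "(\<Sum>xs\<in>words n. sample_prob n M xs) = (\<Sum>xs\<in>words n. sample_prob (length xs) M xs)"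
    by simp
  then show ?thesis
    using lag_law.sum_words[OF lag_law_sample_prob[OF assms]] by simp
qed

lemma KL_single_lag_le:
  assumes lam: "0 < lam" "lam < 1" and lags: "j \<in> lags d" "k \<in> lags d"
    and chains: "stationary_chain d (single_lag lam q j) Mj" "stationary_chain d (single_lag lam q k) Mk"
    and \<delta>: "\<delta> = lam * \<bar>pmf (q True) True - pmf (q False) True\<bar>"
  shows "(\<Sum>xs\<in>words n. sample_prob n Mj xs * ln (sample_prob n Mj xs / sample_prob n Mk xs))
    \<le> 2 * real n * \<delta>\<^sup>2 / (1 - lam)"
proof -
  interpret lag_pair "lag_kernel lam q" "nat (- j)" "nat (- k)" d
    "\<lambda>xs. sample_prob (length xs) Mj xs" "\<lambda>xs. sample_prob (length xs) Mk xs" lam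
    using lag_pair_sample_prob[OF lam lags chains] .
  have "lag_kernel lam q True True - lag_kernel lam q False True
      = lam * (pmf (q True) True - pmf (q False) True)"
    by (simp add: lag_kernel_def algebra_simps)
  then have "gap = \<delta>"
    using lam by (simp add: gap_def \<delta> abs_mult)
  \<comment> \<open>The locale's laws depend on the word alone, so the sample size appears there as
    the length of the word.\<close>
  moreover have "(\<Sum>xs\<in>words n. sample_prob n Mj xs * ln (sample_prob n Mj xs / sample_prob n Mk xs))
      = (\<Sum>xs\<in>words n. sample_prob (length xs) Mj xs
          * ln (sample_prob (length xs) Mj xs / sample_prob (length xs) Mk xs))"
    by simp
  ultimately show ?thesis using KL_words_le[of n] by simp
qed

section \<open>Single-lag models as members of the MTD class\<close>

text \<open>The fair coin with weight \<open>1 - lam\<close> produces the term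
  \<open>(1 - lam) / 2\<close>. The kernel is \<open>q\<close> at every lag, and only the weights
  single out \<open>j\<close>.\<close>

definition single_lag_params :: "real \<Rightarrow> (bool \<Rightarrow> bool pmf) \<Rightarrow> int \<Rightarrow> bool mtd_params" where
  "single_lag_params lam q j =
     \<lparr>mtd_weight = (\<lambda>i. if i = 0 then 1 - lam else if i = j then lam else 0),
      mtd_base = bernoulli_pmf (1 / 2), mtd_kernel = (\<lambda>_. q)\<rparr>"

lemma mtd_valid_single_lag_params:
  assumes "0 < lam" "lam < 1" "j \<in> lags d"
  shows "mtd_valid d (single_lag_params lam q j)"
proof -
  have "{- int d..0} = insert 0 (insert j ({- int d..0} - {0, j}))"
    using assms(3) by (auto simp: lags_def)
  moreover have "(\<Sum>i\<in>insert 0 (insert j ({- int d..0} - {0, j})).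
      mtd_weight (single_lag_params lam q j) i) = 1"
    using assms(3) by (simp add: single_lag_params_def lags_def)
  ultimately show ?thesis
    using assms by (auto simp: mtd_valid_def single_lag_params_def)
qed

lemma pmf_bool_False: "pmf (p :: bool pmf) False = 1 - pmf p True"
proof -
  have "(\<Sum>a\<in>UNIV. pmf p a) = 1" by (rule sum_pmf_eq_1) auto
  then show ?thesis by (simp add: UNIV_bool)
qed

lemma mtd_trans_single_lag_params:
  assumes "j \<in> lags d"
  shows "mtd_trans d (single_lag_params lam q j) = single_lag lam q j"
proof (intro ext)
  fix a x
  have "(\<Sum>i\<in>lags d. mtd_weight (single_lag_params lam q j) i
        * pmf (mtd_kernel (single_lag_params lam q j) i (x i)) a)
      = (\<Sum>i\<in>lags d. if i = j then lam * pmf (q (x j)) a else 0)"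
    using assms by (intro sum.cong) (auto simp: single_lag_params_def lags_def)
  also have "\<dots> = lam * pmf (q (x j)) a"
    using assms by (simp add: lags_def)
  finally show "mtd_trans d (single_lag_params lam q j) a x = single_lag lam q j a x"
    by (cases a) (simp_all add: mtd_trans_def single_lag_def Let_def single_lag_params_def
        pmf_bool_False field_simps)
qed

lemma mtd_delta_single_lag_params:
  assumes "i \<in> lags d" "j \<in> lags d"
  shows "mtd_delta (single_lag_params lam q j) i
    = (if i = j then lam * \<bar>pmf (q True) True - pmf (q False) True\<bar> else 0)"
proof -
  have d_TV: "d_TV (q b) (q c) = \<bar>pmf (q b) True - pmf (q c) True\<bar>" for b c
    by (simp add: d_TV_def UNIV_bool pmf_bool_False)
  have "{d_TV (q b) (q c) | b c. True} = {0, \<bar>pmf (q True) True - pmf (q False) True\<bar>}"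
    unfolding d_TV by (auto simp: ex_bool_eq abs_minus_commute)
  then show ?thesis
    using assms by (auto simp: mtd_delta_def single_lag_params_def lags_def)
qed

lemma single_lag_in_MTD:
  assumes lam: "0 < lam" "lam < 1" and j: "j \<in> lags d"
    and \<delta>: "\<delta> = lam * \<bar>pmf (q True) True - pmf (q False) True\<bar>" "\<delta> > 0"
  shows "single_lag lam q j \<in> MTD d \<delta>" "relevant_lags d (single_lag lam q j) = {j}"
proof -
  let ?\<theta> = "single_lag_params lam q j"
  note valid = mtd_valid_single_lag_params[OF lam j, of q]
  note trans = mtd_trans_single_lag_params[OF j, of lam q]
  have lags: "mtd_lags d ?\<theta> = {j}"
    using j \<delta> by (auto simp: mtd_lags_def mtd_delta_single_lag_params split: if_splits)
  then have "mtd_delta_min d ?\<theta> = \<delta>"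
    using j \<delta> by (simp add: mtd_delta_min_def mtd_delta_single_lag_params)
  then show "single_lag lam q j \<in> MTD d \<delta>"
    unfolding MTD_def using valid trans lags by force
  show "relevant_lags d (single_lag lam q j) = {j}"
    using relevant_lags_mtd_trans[OF valid] trans lags by simp
qed

section \<open>The lower bound for lag estimators\<close>

text \<open>Pigeonhole: the cells are disjoint, so their masses cannot all exceed the
  average.\<close>

lemma exists_rare_cell:
  fixes Q :: "'b \<Rightarrow> real"
  assumes S: "finite S" "\<And>x. x \<in> S \<Longrightarrow> 0 \<le> Q x" "sum Q S \<le> 1"
    and L: "finite L" "L \<noteq> {}"
  shows "\<exists>j\<in>L. sum Q {x\<in>S. g x = j} \<le> 1 / card L"
proof (rule ccontr)
  assume "\<not> ?thesis"
  then have "(\<Sum>j\<in>L. 1 / card L) < (\<Sum>j\<in>L. sum Q {x\<in>S. g x = j})"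
    using L by (intro sum_strict_mono) auto
  also have "\<dots> = sum Q (\<Union>j\<in>L. {x\<in>S. g x = j})"
    using L S by (intro sum.UNION_disjoint[symmetric]) auto
  also have "\<dots> \<le> sum Q S"
    using S by (intro sum_mono2) auto
  finally show False using S L by simp
qed

lemma exists_hard_lag:
  assumes lam: "0 < lam" "lam < 1"
    and \<delta>: "\<delta> = lam * \<bar>pmf (q True) True - pmf (q False) True\<bar>" "\<delta> > 0"
    and d: "1 \<le> d"
    and small: "2 * real n * \<delta>\<^sup>2 / (1 - lam) \<le> ln (real d) / 2 - ln 2"
    and chain: "\<And>j. j \<in> lags d \<Longrightarrow> stationary_chain d (single_lag lam q j) (M j)"
  shows "\<exists>j\<in>lags d. 1 / 4 \<le> \<P>(X in M j. f (sample n X) \<noteq> {j})"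
proof (rule ccontr)
  assume contr: "\<not> ?thesis"
  define P where "P j = sample_prob n (M j)" for j
  have card: "finite (lags d)" "card (lags d) = d" by (simp_all add: lags_def)
  have k: "- 1 \<in> lags d" using d by (simp add: lags_def)
  note pos = sample_prob_pos[OF lam _ chain, where n = n, folded P_def]
  note total = sum_sample_prob[OF lam _ chain, where n = n, folded P_def]
  \<comment> \<open>An estimate may be any set of lags; the cells are indexed by the
    \<open>d\<close> singletons, and the reference law is that of lag -1.\<close>
  have "\<exists>A\<in>(\<lambda>j. {j}) ` lags d. sum (P (- 1)) {xs\<in>words n. f xs = A} \<le> 1 / card ((\<lambda>j. {j}) ` lags d)"
    using k card finite_words total[OF k k] pos[OF k k]
    by (intro exists_rare_cell) (auto intro: less_imp_le)
  then obtain j where j: "j \<in> lags d" "sum (P (- 1)) {xs\<in>words n. f xs = {j}} \<le> 1 / d"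
    using card by (auto simp: card_image)
  have "sum (P j) {xs\<in>words n. f xs = {j}} * ln (real d)
      \<le> (\<Sum>xs\<in>words n. P j xs * ln (P j xs / P (- 1) xs)) + ln 2"
    using d j(2) finite_words pos[OF j(1) j(1)] pos[OF k k] total[OF j(1) j(1)] total[OF k k]
    by (intro prob_mult_ln_le_KL) auto
  \<comment> \<open>The \<open>ln 2\<close> in the hypothesis on \<open>\<delta>\<close> pays for
    the one in the change of measure.\<close>
  also have "\<dots> \<le> ln (real d) / 2"
    using KL_single_lag_le[OF lam j(1) k chain[OF j(1)] chain[OF k] \<delta>(1), of n] small
    by (simp add: P_def)
  finally have upper: "sum (P j) {xs\<in>words n. f xs = {j}} * ln (real d) \<le> ln (real d) / 2" .
  interpret path_law "M j" using path_law_stationary_chain[OF chain[OF j(1)]] .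
  have "sum (P j) {xs\<in>words n. f xs = {j}} + sum (P j) {xs\<in>words n. f xs \<noteq> {j}} = 1"
    unfolding total[OF j(1) j(1), symmetric] using finite_words
    by (subst sum.union_disjoint[symmetric]) (auto intro!: sum.cong)
  then have "3 / 4 < sum (P j) {xs\<in>words n. f xs = {j}}"
    using contr j(1) prob_sample_pred[of "\<lambda>xs. f xs \<noteq> {j}" n] by (auto simp: P_def)
  \<comment> \<open>The smallness hypothesis bounds a nonnegative quantity, so it forces
    \<open>ln d\<close> to be at least \<open>2 * ln 2\<close>.\<close>
  moreover have "0 < ln (real d)"
  proof -
    have "0 \<le> 2 * real n * \<delta>\<^sup>2 / (1 - lam)" using lam by simp
    then show ?thesis using small ln_gt_zero[of "2 :: real"] by linarith
  qed
  ultimately have "3 / 4 * ln (real d) < ln (real d) / 2"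
    using upper by (meson mult_strict_right_mono less_le_trans)
  then show False using \<open>0 < ln (real d)\<close> by simp
qed

theorem proposition2:
  fixes lam \<delta> :: real
    and q :: "bool \<Rightarrow> bool pmf"
    and n d :: nat
  assumes lam: "0 < lam" "lam < 1"
    and delta: "\<delta> = lam * \<bar>pmf (q True) True - pmf (q False) True\<bar>" "\<delta> > 0"
    and nd: "1 \<le> d" "d < n"
  shows
    "(\<forall>j\<in>lags d. \<forall>k\<in>lags d. \<forall>Mj Mk.
        stationary_chain d (single_lag lam q j) Mj \<longrightarrow>
        stationary_chain d (single_lag lam q k) Mk \<longrightarrow>
        KL {xs. length xs = n} (sample_prob n Mj) (sample_prob n Mk)
          \<le> ereal (2 * real n * \<delta>\<^sup>2 / (1 - lam)))
     \<and>
     (\<forall>\<beta>\<in>{0<..<1}. \<forall>PP.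
        real d = real n * \<beta> \<longrightarrow>
        \<delta>\<^sup>2 \<le> (1 - lam) / (2 * real n) * (ln (real n * \<beta>) / 2 - ln 2) \<longrightarrow>
        (\<forall>p\<in>MTD d \<delta>. stationary_chain d p (PP p)) \<longrightarrow>
        (INF f\<in>lag_estimators n d. SUP p\<in>MTD d \<delta>.
            \<P>(X in PP p. f (sample n X) \<noteq> relevant_lags d p)) \<ge> (1/4 :: real))"
proof (intro conjI ballI allI impI)
  fix j k Mj Mk
  assume jk: "j \<in> lags d" "k \<in> lags d"
    and chains: "stationary_chain d (single_lag lam q j) Mj" "stationary_chain d (single_lag lam q k) Mk"
  \<comment> \<open>Every word has positive probability, which rules out the infinite branch of
    \<open>KL\<close>.\<close>
  have "\<not> (\<exists>xs\<in>words n. 0 < sample_prob n Mj xs \<and> sample_prob n Mk xs = 0)"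
    using sample_prob_pos[OF lam jk(2) chains(2), of _ n] by force
  then show "KL (words n) (sample_prob n Mj) (sample_prob n Mk) \<le> ereal (2 * real n * \<delta>\<^sup>2 / (1 - lam))"
    using KL_single_lag_le[OF lam jk chains delta(1), of n] by (simp add: KL_def)
next
  fix \<beta> :: real and PP
  assume d: "real d = real n * \<beta>"
    and small: "\<delta>\<^sup>2 \<le> (1 - lam) / (2 * real n) * (ln (real n * \<beta>) / 2 - ln 2)"
    and chain: "\<forall>p\<in>MTD d \<delta>. stationary_chain d p (PP p)"
  note in_MTD = single_lag_in_MTD[OF lam _ delta]
  have bound: "2 * real n * \<delta>\<^sup>2 / (1 - lam) \<le> ln (real d) / 2 - ln 2"
    using small nd lam unfolding d[symmetric] by (simp add: field_simps)
  show "1 / 4 \<le> (INF f\<in>lag_estimators n d. SUP p\<in>MTD d \<delta>.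
      \<P>(X in PP p. f (sample n X) \<noteq> relevant_lags d p))"
  proof (rule cINF_greatest)
    show "lag_estimators n d \<noteq> {}" by (auto simp: lag_estimators_def)
  next
    fix f :: "bool list \<Rightarrow> int set"
    obtain j where j: "j \<in> lags d"
      "1 / 4 \<le> \<P>(X in PP (single_lag lam q j). f (sample n X) \<noteq> {j})"
      using exists_hard_lag[OF lam delta nd(1) bound, of "\<lambda>j. PP (single_lag lam q j)" f]
        chain in_MTD(1) by auto
    show "1 / 4 \<le> (SUP p\<in>MTD d \<delta>. \<P>(X in PP p. f (sample n X) \<noteq> relevant_lags d p))"
    proof (rule cSUP_upper2)
      show "single_lag lam q j \<in> MTD d \<delta>" using in_MTD(1) j(1) .
      show "1 / 4 \<le> \<P>(X in PP (single_lag lam q j).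
          f (sample n X) \<noteq> relevant_lags d (single_lag lam q j))"
        using in_MTD(2)[OF j(1)] j(2) by simp
      \<comment> \<open>A supremum of reals dominates its members only for a bounded family; error
        probabilities are at most 1.\<close>
      show "bdd_above ((\<lambda>p. \<P>(X in PP p. f (sample n X) \<noteq> relevant_lags d p)) ` MTD d \<delta>)"
        using chain by (intro bdd_aboveI2[where M = 1] prob_space.prob_le_1)
          (auto simp: stationary_chain_def)
    qed
  qed
qed

end
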